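(* Let $N\ge3$ be an integer, $\hat\rho\in(0,1)$, $\lambda>0$, and let $R\ge0$ be an integer. Consider the $N$-player game in which player $i$ chooses $p_i\in[0,1]$ and has the volatility-averse utility $\mathcal U_i(\vec p,\hat\rho,R;\lambda)$ (all players share the same $\hat\rho$, $R$, $\lambda$). Then the game has a unique symmetric Nash equilibrium $(p_{\rm eq},\dots,p_{\rm eq})$, and $p_{\rm eq}$ is the same as in the volatility-neutral case $\lambda=0$: $p_{\rm eq}=0$ if $\hat\rho\le\frac1N$; $p_{\rm eq}=1$ if $\hat\rho\ge1-\frac1N$; and, if $\hat\rho\in(\frac1N,1-\frac1N)$, $p_{\rm eq}\in(0,1)$ is the solution of $$\hat\rho=\frac{p_{\rm eq}-p_{\rm eq}^N}{1-p_{\rm eq}^N-(1-p_{\rm eq})^N}.$$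
   Context: Game: there are $N\ge3$ players. Each player $j$ bets $a_j\in\{0,1\}$ (1 = Heads, 0 = Tails) on an outcome $w\in\{0,1\}$. The payoff of player $i$ is $u_i(\vec a\mid w)=0$ if no $j$ has $a_j=w$, and otherwise $u_i(\vec a\mid w)=N\,\dfrac{\delta_{w,a_i}}{\sum_j\delta_{w,a_j}}-1$, with $\delta$ the Kronecker delta. A strategy $p_j\in[0,1]$ is the probability that player $j$ bets 1; under $\mathbb E_{\vec a}$ the $a_j$ are independent Bernoulli($p_j$). The volatility-neutral utility is $\mathcal U_i(\vec p,\hat\rho)=\hat\rho\,\mathbb E_{\vec a}[u_i(\vec a\mid 1)]+(1-\hat\rho)\,\mathbb E_{\vec a}[u_i(\vec a\mid 0)]$. The volatility-averse utility is $$\mathcal U_i(\vec p,\hat\rho,R;\lambda)=\mathcal U_i(\vec p,\hat\rho)-\lambda\,\big(\mathbb E_{\vec a}[u_i(\vec a\mid 1)-u_i(\vec a\mid 0)]\big)^2\,\frac{\hat\rho(1-\hat\rho)}{R+3},$$ where the last term is $\lambda$ times the variance of $\mathcal U_i(\vec p,\rho)$ when $\rho$ is Beta-distributed with mean $\hat\rho$ and variance $\hat\rho(1-\hat\rho)/(R+3)$ ($R$ being the length of the observed data string). A Nash equilibrium is a profile in $[0,1]^N$ in which no player can increase her own utility by unilaterally changing her own $p_i\in[0,1]$; it is symmetric if all $p_i$ are equal. *)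

theory Defs
  imports "HOL-Probability.Probability" "HOL-Probability.Product_PMF"
begin

text \<open>The players are the numbers below \<open>N\<close>. A bet or an outcome is a Boolean, with
  \<open>True\<close> for 1 (Heads) and \<open>False\<close> for 0 (Tails).\<close>

definition payoff :: "nat \<Rightarrow> nat \<Rightarrow> (nat \<Rightarrow> bool) \<Rightarrow> bool \<Rightarrow> real" where
  "payoff N i a w =
     (if \<exists>j<N. a j = w
      then real N * (of_bool (w = a i) / (\<Sum>j<N. of_bool (w = a j))) - 1
      else 0)"

definition bets :: "nat \<Rightarrow> (nat \<Rightarrow> real) \<Rightarrow> (nat \<Rightarrow> bool) pmf" where
  "bets N p = Pi_pmf {..<N} False (\<lambda>j. bernoulli_pmf (p j))"

definition neutral_utility :: "nat \<Rightarrow> real \<Rightarrow> nat \<Rightarrow> (nat \<Rightarrow> real) \<Rightarrow> real" where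
  "neutral_utility N \<rho> i p =
     \<rho> * measure_pmf.expectation (bets N p) (\<lambda>a. payoff N i a True) +
     (1 - \<rho>) * measure_pmf.expectation (bets N p) (\<lambda>a. payoff N i a False)"

text \<open>The factor \<open>\<rho> * (1 - \<rho>) / (R + 3)\<close> is the variance of the Beta distribution that
  describes the belief about the probability of Heads; \<open>neutral_utility\<close> is affine in this
  probability, with the expected difference of payoffs as its slope. Hence \<open>\<Lambda>\<close> multiplies
  the variance of the neutral utility under this belief.\<close>

definition averse_utility ::
    "nat \<Rightarrow> real \<Rightarrow> nat \<Rightarrow> real \<Rightarrow> nat \<Rightarrow> (nat \<Rightarrow> real) \<Rightarrow> real" where
  "averse_utility N \<rho> R \<Lambda> i p =
     neutral_utility N \<rho> i p -
     \<Lambda> * (measure_pmf.expectation (bets N p) (\<lambda>a. payoff N i a True - payoff N i a False))\<^sup>2 *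
       (\<rho> * (1 - \<rho>) / (real R + 3))"

text \<open>Profiles are extensional (\<open>undefined\<close> outside the set of players), so that two profiles
  are equal as functions if and only if they agree on all players.\<close>

definition profiles :: "nat \<Rightarrow> (nat \<Rightarrow> real) set" where
  "profiles N = {..<N} \<rightarrow>\<^sub>E {0..1}"

definition nash_equilibrium ::
    "nat \<Rightarrow> (nat \<Rightarrow> (nat \<Rightarrow> real) \<Rightarrow> real) \<Rightarrow> (nat \<Rightarrow> real) \<Rightarrow> bool" where
  "nash_equilibrium N U p \<longleftrightarrow>
     p \<in> profiles N \<and> (\<forall>i<N. \<forall>q\<in>{0..1}. U i (p(i := q)) \<le> U i p)"

definition symmetric_nash_equilibrium ::
    "nat \<Rightarrow> (nat \<Rightarrow> (nat \<Rightarrow> real) \<Rightarrow> real) \<Rightarrow> (nat \<Rightarrow> real) \<Rightarrow> bool" where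
  "symmetric_nash_equilibrium N U p \<longleftrightarrow>
     nash_equilibrium N U p \<and> (\<forall>i<N. \<forall>j<N. p i = p j)"

end

theory Submission
  imports Defs
begin

text \<open>Suppose one player bets Heads with probability \<open>q\<close> and all the others with probability
  \<open>p\<close>, and write \<open>S x\<close> for the sum of \<open>x ^ k\<close> over \<open>k < N - 1\<close>. The expected payoff of this
  player given Heads is \<open>(q - p) * S (1 - p)\<close>, and given Tails it is \<open>-(q - p) * S p\<close>. The
  neutral utility of the deviation is therefore \<open>(q - p) * D p\<close> with
  \<open>D p = \<rho> * S (1 - p) - (1 - \<rho>) * S p\<close>, and volatility aversion subtracts a nonnegative multiple
  of \<open>(q - p)\<^sup>2\<close>. This penalty is of second order at \<open>q = p\<close>, so in both games \<open>p\<close> is an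
  equilibrium exactly if \<open>D p\<close> satisfies the first-order condition on \<open>[0, 1]\<close>. Since \<open>D\<close> is
  continuous and strictly decreasing, with \<open>D 0 = N * \<rho> - 1\<close> and \<open>D 1 = N * \<rho> - (N - 1)\<close>,
  exactly one \<open>p\<close> does.\<close>

section \<open>Expected payoffs\<close>

text \<open>Absorption turns \<open>(n choose k) * (n + 1) / (k + 1)\<close> into
  \<open>Suc n choose Suc k\<close>. Hence \<open>x\<close> times the left side is the expansion of
  \<open>(x + (1 - x)) ^ Suc n\<close> without its lowest term, and the geometric sum formula
  applies. It evaluates a winner's expected share against \<open>n\<close> opponents.\<close>

lemma sum_binomial_div_Suc:
  fixes x :: real
  shows "(\<Sum>k\<le>n. real (n choose k) * x ^ k * (1 - x) ^ (n - k) * (real (Suc n) / (1 + real k)))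
    = (\<Sum>k<Suc n. (1 - x) ^ k)" (is "?L = ?R")
proof (cases "x = 0")
  case True
  have "?L = (\<Sum>k\<in>{0}. real (n choose k) * x ^ k * (1 - x) ^ (n - k) * (real (Suc n) / (1 + real k)))"
    using True by (intro sum.mono_neutral_right) auto
  then show ?thesis
    using True by simp
next
  case False
  have absorb: "real (n choose k) * (real (Suc n) / (1 + real k)) = real (Suc n choose Suc k)" for k
  proof -
    have "real (Suc k) * real (Suc n choose Suc k) = real (Suc n) * real (n choose k)"
      by (simp only: of_nat_mult[symmetric] Suc_times_binomial)
    then show ?thesis
      by (simp add: field_simps del: binomial_Suc_Suc)
  qed
  have "1 = (x + (1 - x)) ^ Suc n"
    by simp
  also have "\<dots> = (\<Sum>k\<le>Suc n. real (Suc n choose k) * x ^ k * (1 - x) ^ (Suc n - k))"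
    by (rule binomial_ring)
  also have "\<dots> = (1 - x) ^ Suc n
      + (\<Sum>k\<le>n. real (Suc n choose Suc k) * x ^ Suc k * (1 - x) ^ (n - k))"
    by (subst sum.atMost_Suc_shift) simp
  also have "(\<Sum>k\<le>n. real (Suc n choose Suc k) * x ^ Suc k * (1 - x) ^ (n - k)) = x * ?L"
    by (simp add: absorb[symmetric] sum_distrib_left mult_ac del: binomial_Suc_Suc of_nat_Suc)
  finally have "x * ?L = 1 - (1 - x) ^ Suc n"
    by simp
  also have "\<dots> = x * ?R"
    using one_diff_power_eq[of "1 - x" "Suc n"] by simp
  finally show ?thesis
    using False by simp
qed

lemma sum_binomial_pos:
  fixes x :: real
  shows "(\<Sum>k\<le>n. real (n choose k) * x ^ k * (1 - x) ^ (n - k) * of_bool (0 < k))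
    = 1 - (1 - x) ^ n"
proof -
  have "1 = (x + (1 - x)) ^ n"
    by simp
  also have "\<dots> = (\<Sum>k\<le>n. real (n choose k) * x ^ k * (1 - x) ^ (n - k))"
    by (rule binomial_ring)
  finally show ?thesis
    by (simp add: sum.atMost_shift)
qed

lemma binomial_pmf_card_eq:
  assumes "finite A" and "p \<in> {0..1}"
  shows "map_pmf (\<lambda>f. card {j \<in> A. f j = w}) (Pi_pmf A False (\<lambda>_. bernoulli_pmf p))
    = binomial_pmf (card A) (if w then p else 1 - p)"
proof (cases w)
  case True
  then show ?thesis
    using binomial_pmf_altdef'[OF assms(1) refl assms(2)] by simp
next
  case False
  have not: "bernoulli_pmf (1 - p) = map_pmf Not (bernoulli_pmf p)"
  proof (rule pmf_eqI)
    fix b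
    have "pmf (map_pmf Not (bernoulli_pmf p)) (\<not> \<not> b) = pmf (bernoulli_pmf p) (\<not> b)"
      by (rule pmf_map_inj') (simp add: inj_def)
    then show "pmf (bernoulli_pmf (1 - p)) b = pmf (map_pmf Not (bernoulli_pmf p)) b"
      using assms(2) by (cases b) auto
  qed
  \<comment> \<open>The default here is \<open>True\<close> because negating every bet also negates
    the default \<open>False\<close>.\<close>
  have "binomial_pmf (card A) (1 - p)
      = map_pmf (\<lambda>f. card {j \<in> A. f j}) (Pi_pmf A True (\<lambda>_. bernoulli_pmf (1 - p)))"
    using assms by (intro binomial_pmf_altdef') auto
  also have "Pi_pmf A True (\<lambda>_. bernoulli_pmf (1 - p))
      = map_pmf (\<lambda>f. Not \<circ> f) (Pi_pmf A False (\<lambda>_. bernoulli_pmf p))"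
    unfolding not using assms(1) by (rule Pi_pmf_map) simp
  finally show ?thesis
    using False by (simp add: pmf.map_comp o_def)
qed

text \<open>Once the own bet \<open>x\<close> is fixed, the opponents matter only through how many
  of them are right. This makes the payoff a function of a binomial variable.\<close>

lemma payoff_fun_upd:
  assumes "i < N"
  shows "payoff N i (f(i := x)) w =
    (let k = card {j \<in> {..<N} - {i}. f j = w}
     in if x = w then real N / (1 + real k) - 1 else - of_bool (0 < k))"
proof -
  let ?B = "{j \<in> {..<N} - {i}. f j = w}"
  have "(\<Sum>j<N. of_bool (w = (f(i := x)) j))
      = of_bool (w = x) + (\<Sum>j\<in>{..<N} - {i}. of_bool (w = (f(i := x)) j) :: real)"
    using assms by (subst sum.remove[of _ i]) auto
  also have "(\<Sum>j\<in>{..<N} - {i}. of_bool (w = (f(i := x)) j) :: real)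
      = (\<Sum>j\<in>{..<N} - {i}. of_bool (f j = w))"
    by (intro sum.cong) auto
  also have "\<dots> = real (card ?B)"
    by (simp add: Int_def)
  finally have total: "(\<Sum>j<N. of_bool (w = (f(i := x)) j)) = of_bool (w = x) + real (card ?B)" .
  have ex: "(\<exists>j<N. (f(i := x)) j = w) \<longleftrightarrow> x = w \<or> 0 < card ?B"
    using assms by (auto simp: card_gt_0_iff)
  show ?thesis
    unfolding payoff_def total ex by (auto simp: Let_def)
qed

text \<open>Condition on the player's own bet: the number of opponents who are right is then
  binomial, and the two binomial sums above give the expected payoff of a right and of a wrong
  bet.\<close>

lemma expectation_payoff_deviation:
  assumes "i < N" and p: "p \<in> {0..1}" and q: "q \<in> {0..1}"
    and r: "r i = q" "\<And>j. j < N \<Longrightarrow> j \<noteq> i \<Longrightarrow> r j = p"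
  shows "measure_pmf.expectation (bets N r) (\<lambda>a. payoff N i a w)
    = (if w then q - p else p - q) * (\<Sum>k<N - 1. (1 - (if w then p else 1 - p)) ^ k)"
proof -
  define A where "A = {..<N} - {i}"
  \<comment> \<open>\<open>s\<close> and \<open>t\<close> are the probabilities of betting on
    \<open>w\<close>, for each opponent and for player \<open>i\<close>; they treat both outcomes at
    once.\<close>
  define s where "s = (if w then p else 1 - p)"
  define t where "t = (if w then q else 1 - q)"
  define P where "P = Pi_pmf A False (\<lambda>_. bernoulli_pmf p)"
  define g where "g x k = (if x = w then real N / (1 + real k) - 1 else - of_bool (0 < k))"
    for x :: bool and k :: nat
  define n where "n = N - 1"
  have N: "N = Suc n"
    using assms(1) by (simp add: n_def)
  have A: "finite A" "i \<notin> A" "card A = n" "{..<N} = insert i A"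
    using assms(1) by (auto simp: A_def n_def)
  have s: "s \<in> {0..1}"
    using p by (auto simp: s_def)
  have rest: "Pi_pmf A False (\<lambda>j. bernoulli_pmf (r j)) = P"
    unfolding P_def by (rule Pi_pmf_cong) (auto simp: A_def r)
  have finP: "finite (set_pmf P)"
    unfolding P_def using A(1)
    by (intro finite_subset[OF set_Pi_pmf_subset'] finite_PiE_dflt) auto
  have others: "measure_pmf.expectation P (\<lambda>f. payoff N i (f(i := x)) w)
      = (\<Sum>k\<le>n. real (n choose k) * s ^ k * (1 - s) ^ (n - k) * g x k)" for x
  proof -
    have "measure_pmf.expectation P (\<lambda>f. payoff N i (f(i := x)) w)
        = measure_pmf.expectation (map_pmf (\<lambda>f. card {j \<in> A. f j = w}) P) (g x)"
      using assms(1) by (simp add: payoff_fun_upd g_def A_def Let_def)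
    also have "map_pmf (\<lambda>f. card {j \<in> A. f j = w}) P = binomial_pmf n s"
      unfolding P_def s_def using binomial_pmf_card_eq[OF A(1) p] A(3) by simp
    also have "measure_pmf.expectation (binomial_pmf n s) (g x)
        = (\<Sum>k\<le>n. real (n choose k) * s ^ k * (1 - s) ^ (n - k) * g x k)"
      using s by (simp add: expectation_binomial_pmf')
    finally show ?thesis .
  qed
  have one: "(\<Sum>k\<le>n. real (n choose k) * s ^ k * (1 - s) ^ (n - k)) = 1"
    using binomial_ring[of s "1 - s" n] by simp
  have g_w: "g w k = real (Suc n) / (1 + real k) - 1"
    and g_not_w: "g (\<not> w) k = - of_bool (0 < k)" for k
    by (simp_all add: g_def N)
  have win: "measure_pmf.expectation P (\<lambda>f. payoff N i (f(i := w)) w)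
      = (\<Sum>k<Suc n. (1 - s) ^ k) - 1"
    by (simp only: others g_w right_diff_distrib sum_subtractf sum_binomial_div_Suc one mult_1_right)
  have lose: "measure_pmf.expectation P (\<lambda>f. payoff N i (f(i := (\<not> w))) w)
      = (1 - s) ^ n - 1"
    by (simp only: others g_not_w mult_minus_right sum_negf sum_binomial_pos minus_diff_eq)
  have "measure_pmf.expectation (bets N r) (\<lambda>a. payoff N i a w)
      = measure_pmf.expectation
          (bernoulli_pmf q \<bind> (\<lambda>x. map_pmf (\<lambda>f. f(i := x)) P)) (\<lambda>a. payoff N i a w)"
    unfolding bets_def A(4) Pi_pmf_insert'[OF A(1,2)] rest r(1) by (simp add: map_pmf_def)
  also have "\<dots> = (\<Sum>x\<in>UNIV. pmf (bernoulli_pmf q) x *\<^sub>R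
      measure_pmf.expectation (map_pmf (\<lambda>f. f(i := x)) P) (\<lambda>a. payoff N i a w))"
    using finP by (intro pmf_expectation_bind) auto
  also have "\<dots> = t * ((\<Sum>k<Suc n. (1 - s) ^ k) - 1) + (1 - t) * ((1 - s) ^ n - 1)"
    using q win lose by (cases w) (auto simp: UNIV_bool t_def)
  \<comment> \<open>The terms \<open>t * (1 - s) ^ n\<close> from the two cases cancel, so the sum
    loses its last summand. The remaining constant is \<open>s\<close> times the same sum, which
    produces the factor \<open>t - s\<close>.\<close>
  also have "\<dots> = t * (\<Sum>k<n. (1 - s) ^ k) - (1 - (1 - s) ^ n)"
    by (simp add: algebra_simps)
  also have "\<dots> = (t - s) * (\<Sum>k<n. (1 - s) ^ k)"
    using one_diff_power_eq[of "1 - s" n] by (simp add: algebra_simps)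
  also have "t - s = (if w then q - p else p - q)"
    by (simp add: s_def t_def)
  finally show ?thesis
    by (simp add: s_def n_def)
qed

section \<open>The first-order condition\<close>

text \<open>The slope \<open>D p\<close> of a player's neutral utility in her own strategy when all
  others play \<open>p\<close>.\<close>

definition marginal_utility :: "nat \<Rightarrow> real \<Rightarrow> real \<Rightarrow> real" where
  "marginal_utility N \<rho> p = \<rho> * (\<Sum>k<N - 1. (1 - p) ^ k) - (1 - \<rho>) * (\<Sum>k<N - 1. p ^ k)"

lemma neutral_utility_deviation:
  assumes "i < N" and "p \<in> {0..1}" and "q \<in> {0..1}"
    and "r i = q" "\<And>j. j < N \<Longrightarrow> j \<noteq> i \<Longrightarrow> r j = p"
  shows "neutral_utility N \<rho> i r = (q - p) * marginal_utility N \<rho> p"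
  unfolding neutral_utility_def marginal_utility_def
  by (simp add: expectation_payoff_deviation[OF assms(1-3), where r = r, OF assms(4,5)] algebra_simps)

lemma averse_utility_deviation:
  assumes "i < N" and "p \<in> {0..1}" and "q \<in> {0..1}"
    and "r i = q" "\<And>j. j < N \<Longrightarrow> j \<noteq> i \<Longrightarrow> r j = p"
  shows "averse_utility N \<rho> R \<Lambda> i r = (q - p) * marginal_utility N \<rho> p
    - \<Lambda> * ((\<Sum>k<N - 1. (1 - p) ^ k) + (\<Sum>k<N - 1. p ^ k))\<^sup>2 * (\<rho> * (1 - \<rho>) / (real R + 3))
      * (q - p)\<^sup>2"
proof -
  \<comment> \<open>Finite support gives the integrability needed to split the expected
    difference.\<close>
  have "finite (set_pmf (bets N r))"
    unfolding bets_def
    by (intro finite_subset[OF set_Pi_pmf_subset'] finite_PiE_dflt) auto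
  then have "measure_pmf.expectation (bets N r) (\<lambda>a. payoff N i a True - payoff N i a False)
      = (q - p) * ((\<Sum>k<N - 1. (1 - p) ^ k) + (\<Sum>k<N - 1. p ^ k))"
    by (subst Bochner_Integration.integral_diff)
       (auto intro!: integrable_measure_pmf_finite
         simp: expectation_payoff_deviation[OF assms(1-3), where r = r, OF assms(4,5)] algebra_simps)
  then show ?thesis
    unfolding averse_utility_def
    by (simp add: neutral_utility_deviation[OF assms(1-3), where r = r, OF assms(4,5)] power_mult_distrib)
qed

lemma linear_coeff_nonpos:
  fixes D K m :: real
  assumes "0 < m" and "0 \<le> K" and le: "\<And>t. t \<in> {0..m} \<Longrightarrow> t * D - K * t\<^sup>2 \<le> 0"
  shows "D \<le> 0"
proof (rule ccontr)
  assume "\<not> D \<le> 0"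
  \<comment> \<open>A step so short that the linear term wins:
    \<open>K * t < (K + 1) * t \<le> D\<close>. Using \<open>K + 1\<close> also avoids division by
    zero at \<open>K = 0\<close>.\<close>
  define t where "t = min m (D / (K + 1))"
  have t: "0 < t" "t \<le> m" "t \<le> D / (K + 1)"
    using \<open>\<not> D \<le> 0\<close> assms(1,2) by (auto simp: t_def)
  have "t * (D - K * t) \<le> 0"
    using le[of t] t by (simp add: power2_eq_square algebra_simps)
  then have "D \<le> K * t"
    using t(1) by (simp add: mult_le_0_iff)
  moreover have "t * (K + 1) \<le> D"
    using t(3) assms(2) by (simp add: pos_le_divide_eq)
  ultimately show False
    using t(1) by (simp add: algebra_simps)
qed

text \<open>Short steps to the right and to the left, where there is room, force the sign of
  \<open>D\<close>. Conversely, these signs make the linear term nonpositive, and the quadratic term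
  only lowers the value.\<close>

lemma quadratic_nonpos_on_unit_interval_iff:
  fixes D K p :: real
  assumes "0 \<le> K" and p: "p \<in> {0..1}"
  shows "(\<forall>q\<in>{0..1}. (q - p) * D - K * (q - p)\<^sup>2 \<le> 0) \<longleftrightarrow> (p = 0 \<or> 0 \<le> D) \<and> (p = 1 \<or> D \<le> 0)"
    (is "?L \<longleftrightarrow> ?R")
proof
  assume L: ?L
  have "D \<le> 0" if "p \<noteq> 1"
  proof (rule linear_coeff_nonpos)
    show "0 < 1 - p"
      using p that by simp
    show "t * D - K * t\<^sup>2 \<le> 0" if "t \<in> {0..1 - p}" for t
      using bspec[OF L, of "p + t"] that p by simp
  qed fact
  moreover have "- D \<le> 0" if "p \<noteq> 0"
  proof (rule linear_coeff_nonpos)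
    show "0 < p"
      using p that by simp
    show "t * (- D) - K * t\<^sup>2 \<le> 0" if "t \<in> {0..p}" for t
      using bspec[OF L, of "p - t"] that p by simp
  qed fact
  ultimately show ?R
    by auto
next
  assume R: ?R
  show ?L
  proof
    fix q :: real
    assume q: "q \<in> {0..1}"
    have "(q - p) * D \<le> 0"
      using R p q by (auto simp: mult_le_0_iff)
    moreover have "0 \<le> K * (q - p)\<^sup>2"
      using assms(1) by simp
    ultimately show "(q - p) * D - K * (q - p)\<^sup>2 \<le> 0"
      by linarith
  qed
qed

definition first_order_condition :: "nat \<Rightarrow> real \<Rightarrow> real \<Rightarrow> bool" where
  "first_order_condition N \<rho> p \<longleftrightarrow> p \<in> {0..1} \<and>
     (p = 0 \<or> 0 \<le> marginal_utility N \<rho> p) \<and> (p = 1 \<or> marginal_utility N \<rho> p \<le> 0)"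

text \<open>The coefficient \<open>K\<close> is left abstract to cover both games; the neutral one
  is the case \<open>K = 0\<close>.\<close>

lemma symmetric_nash_equilibria_eq:
  assumes "0 < N" and "\<And>x. 0 \<le> K x"
    and U: "\<And>i x q r. \<lbrakk>i < N; x \<in> {0..1}; q \<in> {0..1}; r i = q;
        \<And>j. j < N \<Longrightarrow> j \<noteq> i \<Longrightarrow> r j = x\<rbrakk>
      \<Longrightarrow> U i r = (q - x) * marginal_utility N \<rho> x - K x * (q - x)\<^sup>2"
  shows "{p. symmetric_nash_equilibrium N U p}
    = (\<lambda>x. \<lambda>i\<in>{..<N}. x) ` {x. first_order_condition N \<rho> x}"
proof -
  have const: "symmetric_nash_equilibrium N U (\<lambda>i\<in>{..<N}. x) \<longleftrightarrow> first_order_condition N \<rho> x"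
    for x
  proof (cases "x \<in> {0..1}")
    case True
    have dev: "U i ((\<lambda>i\<in>{..<N}. x)(i := q))
        = (q - x) * marginal_utility N \<rho> x - K x * (q - x)\<^sup>2"
      if "i < N" "q \<in> {0..1}" for i q
      using that True by (intro U) auto
    \<comment> \<open>Not deviating is the case \<open>q = x\<close>, so being an equilibrium means
      that the quadratic is nowhere positive.\<close>
    have stay: "U i (\<lambda>i\<in>{..<N}. x) = 0" if "i < N" for i
      using U[of i x x "\<lambda>i\<in>{..<N}. x"] that True by simp
    have "symmetric_nash_equilibrium N U (\<lambda>i\<in>{..<N}. x) \<longleftrightarrow>
        (\<forall>i<N. \<forall>q\<in>{0..1}. (q - x) * marginal_utility N \<rho> x - K x * (q - x)\<^sup>2 \<le> 0)"
      using True
      by (auto simp: symmetric_nash_equilibrium_def nash_equilibrium_def profiles_def dev stay)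
    then show ?thesis
      using assms(1) True quadratic_nonpos_on_unit_interval_iff[OF assms(2)[of x] True]
      unfolding first_order_condition_def by blast
  next
    case False
    then show ?thesis
      using assms(1)
      by (auto simp: first_order_condition_def symmetric_nash_equilibrium_def
          nash_equilibrium_def profiles_def PiE_iff)
  qed
  have eq: "p = (\<lambda>i\<in>{..<N}. p 0)" if "symmetric_nash_equilibrium N U p" for p
  proof
    fix i
    have "p \<in> extensional {..<N}" and "\<forall>i<N. \<forall>j<N. p i = p j"
      using that
      unfolding symmetric_nash_equilibrium_def nash_equilibrium_def profiles_def PiE_def
      by blast+
    then have "p i = (if i < N then p 0 else undefined)"
      using assms(1) by (metis extensional_arb lessThan_iff)
    then show "p i = (\<lambda>i\<in>{..<N}. p 0) i"
      by (simp only: restrict_apply lessThan_iff)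
  qed
  show ?thesis
  proof (intro equalityI subsetI)
    fix p
    assume "p \<in> {p. symmetric_nash_equilibrium N U p}"
    then have p: "symmetric_nash_equilibrium N U p"
      by simp
    then have "first_order_condition N \<rho> (p 0)"
      using const[of "p 0"] by (simp only: eq[OF p, symmetric])
    then show "p \<in> (\<lambda>x. \<lambda>i\<in>{..<N}. x) ` {x. first_order_condition N \<rho> x}"
      using eq[OF p] by (intro image_eqI[of _ _ "p 0"]) simp_all
  qed (use const in blast)
qed

section \<open>Solving the first-order condition\<close>

lemma marginal_utility_strict_antimono:
  assumes "3 \<le> N" and "0 < \<rho>" and "\<rho> < 1" and "0 \<le> x" and "x < y" and "y \<le> 1"
  shows "marginal_utility N \<rho> y < marginal_utility N \<rho> x"
proof -
  have mono: "(\<Sum>k<N - 1. a ^ k) < (\<Sum>k<N - 1. b ^ k)" if "0 \<le> a" "a < b" for a b :: real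
  proof (rule sum_strict_mono_ex1)
    show "\<forall>k\<in>{..<N - 1}. a ^ k \<le> b ^ k"
      using that by (auto intro: power_mono)
    show "\<exists>k\<in>{..<N - 1}. a ^ k < b ^ k"
      \<comment> \<open>The terms for \<open>k = 0\<close> agree; the first strict gain is at
        \<open>k = 1\<close>, which is in range because \<open>3 \<le> N\<close>.\<close>
      using that assms(1) by (intro bexI[of _ 1]) auto
  qed simp
  have "\<rho> * (\<Sum>k<N - 1. (1 - y) ^ k) < \<rho> * (\<Sum>k<N - 1. (1 - x) ^ k)"
    using mono[of "1 - y" "1 - x"] assms by simp
  moreover have "(1 - \<rho>) * (\<Sum>k<N - 1. x ^ k) < (1 - \<rho>) * (\<Sum>k<N - 1. y ^ k)"
    using mono[of x y] assms by simp
  ultimately show ?thesis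
    by (simp add: marginal_utility_def)
qed

lemma marginal_utility_0:
  assumes "2 \<le> N"
  shows "marginal_utility N \<rho> 0 = \<rho> * real N - 1"
  using assms by (simp add: marginal_utility_def power_0_left of_nat_diff algebra_simps)

lemma marginal_utility_1:
  assumes "2 \<le> N"
  shows "marginal_utility N \<rho> 1 = \<rho> * real N - (real N - 1)"
  using assms by (simp add: marginal_utility_def power_0_left of_nat_diff algebra_simps)

text \<open>With \<open>S\<close> and \<open>T\<close> the geometric sums of \<open>q\<close> and
  \<open>1 - q\<close>, numerator and denominator share the factor \<open>q * (1 - q)\<close>. The
  quotient reduces to \<open>S / (S + T)\<close>, the root in \<open>\<rho>\<close> of
  \<open>\<rho> * (S + T) - S\<close>.\<close>

lemma marginal_utility_eq_0_iff:
  assumes "2 \<le> N" and "q \<in> {0<..<1}"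
  shows "marginal_utility N \<rho> q = 0 \<longleftrightarrow> \<rho> = (q - q ^ N) / (1 - q ^ N - (1 - q) ^ N)"
proof -
  define n where "n = N - 1"
  have N: "N = Suc n" and "0 < n"
    using assms(1) by (auto simp: n_def)
  define S where "S = (\<Sum>k<n. q ^ k)"
  define T where "T = (\<Sum>k<n. (1 - q) ^ k)"
  have pos: "0 < S" "0 < T"
    unfolding S_def T_def using assms(2) \<open>0 < n\<close> by (auto intro!: sum_pos)
  have "1 - q ^ n = (1 - q) * S" and "1 - (1 - q) ^ n = q * T"
    unfolding S_def T_def using one_diff_power_eq[of q n] one_diff_power_eq[of "1 - q" n] by auto
  then have powers: "q ^ n = 1 - (1 - q) * S" "(1 - q) ^ n = 1 - q * T"
    by linarith+
  have num: "q - q ^ N = q * (1 - q) * S"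
    by (simp add: N powers algebra_simps)
  have den: "1 - q ^ N - (1 - q) ^ N = q * (1 - q) * (S + T)"
    by (simp add: N powers algebra_simps)
  have "(q - q ^ N) / (1 - q ^ N - (1 - q) ^ N) = S / (S + T)"
    unfolding num den using assms(2) by simp
  moreover have "marginal_utility N \<rho> q = \<rho> * (S + T) - S"
    by (simp add: marginal_utility_def S_def T_def n_def algebra_simps)
  moreover have "\<rho> * (S + T) - S = 0 \<longleftrightarrow> \<rho> = S / (S + T)"
    using pos by (simp add: eq_divide_eq)
  ultimately show ?thesis
    by simp
qed

lemma ex1_first_order_condition:
  assumes "3 \<le> N" and "0 < \<rho>" and "\<rho> < 1"
  shows "\<exists>!p. first_order_condition N \<rho> p"
proof (rule ex_ex1I)
  show "\<exists>p. first_order_condition N \<rho> p"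
  proof (cases "marginal_utility N \<rho> 0 \<le> 0 \<or> 0 \<le> marginal_utility N \<rho> 1")
    case True
    then show ?thesis
      by (auto simp: first_order_condition_def intro: exI[of _ 0] exI[of _ 1])
  next
    case False
    have "continuous_on {0..1} (marginal_utility N \<rho>)"
      unfolding marginal_utility_def by (intro continuous_intros)
    then have "\<exists>p\<ge>0. p \<le> 1 \<and> marginal_utility N \<rho> p = 0"
      using False by (intro IVT2') auto
    then show ?thesis
      by (auto simp: first_order_condition_def)
  qed
next
  \<comment> \<open>If \<open>x < y\<close>, then \<open>x \<noteq> 1\<close> and
    \<open>y \<noteq> 0\<close>, so the slope is at most 0 at \<open>x\<close> and at least 0 at
    \<open>y\<close>, although it strictly decreases.\<close>
  have "\<not> x < y" if "first_order_condition N \<rho> x" "first_order_condition N \<rho> y" for x y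
    using marginal_utility_strict_antimono[OF assms, of x y] that
    by (force simp: first_order_condition_def)
  then show "x = y" if "first_order_condition N \<rho> x" "first_order_condition N \<rho> y" for x y
    using that by (meson linorder_neqE_linordered_idom)
qed

theorem mainTheorem5:
  fixes N R :: nat and \<rho> \<Lambda> :: real
  assumes "N \<ge> 3" and "0 < \<rho>" and "\<rho> < 1" and "\<Lambda> > 0"
  shows "\<exists>p_eq :: real.
    {p. symmetric_nash_equilibrium N (averse_utility N \<rho> R \<Lambda>) p} = {\<lambda>i\<in>{..<N}. p_eq} \<and>
    {p. symmetric_nash_equilibrium N (neutral_utility N \<rho>) p} = {\<lambda>i\<in>{..<N}. p_eq} \<and>
    (\<rho> \<le> 1 / real N \<longrightarrow> p_eq = 0) \<and>
    (\<rho> \<ge> 1 - 1 / real N \<longrightarrow> p_eq = 1) \<and>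
    (1 / real N < \<rho> \<and> \<rho> < 1 - 1 / real N \<longrightarrow>
       {q \<in> {0<..<1}. \<rho> = (q - q ^ N) / (1 - q ^ N - (1 - q) ^ N)} = {p_eq})"
proof -
  obtain x where x: "first_order_condition N \<rho> x"
    and unique: "\<And>y. first_order_condition N \<rho> y \<Longrightarrow> y = x"
    using ex1_first_order_condition[OF assms(1-3)] by blast
  have X: "{x. first_order_condition N \<rho> x} = {x}"
    using x unique by blast
  have averse: "{p. symmetric_nash_equilibrium N (averse_utility N \<rho> R \<Lambda>) p} = {\<lambda>i\<in>{..<N}. x}"
  proof -
    define K where "K x = \<Lambda> * ((\<Sum>k<N - 1. (1 - x) ^ k) + (\<Sum>k<N - 1. x ^ k))\<^sup>2
      * (\<rho> * (1 - \<rho>) / (real R + 3))" for x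
    have "{p. symmetric_nash_equilibrium N (averse_utility N \<rho> R \<Lambda>) p}
        = (\<lambda>x. \<lambda>i\<in>{..<N}. x) ` {x. first_order_condition N \<rho> x}"
    proof (rule symmetric_nash_equilibria_eq)
      show "averse_utility N \<rho> R \<Lambda> i r
          = (q - x) * marginal_utility N \<rho> x - K x * (q - x)\<^sup>2"
        if "i < N" "x \<in> {0..1}" "q \<in> {0..1}" "r i = q" "\<And>j. j < N \<Longrightarrow> j \<noteq> i \<Longrightarrow> r j = x"
        for i x q r
        unfolding K_def using that by (rule averse_utility_deviation)
    qed (use assms in \<open>simp_all add: K_def\<close>)
    then show ?thesis
      by (simp add: X)
  qed
  have neutral: "{p. symmetric_nash_equilibrium N (neutral_utility N \<rho>) p} = {\<lambda>i\<in>{..<N}. x}"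
  proof -
    have "{p. symmetric_nash_equilibrium N (neutral_utility N \<rho>) p}
        = (\<lambda>x. \<lambda>i\<in>{..<N}. x) ` {x. first_order_condition N \<rho> x}"
    proof (rule symmetric_nash_equilibria_eq)
      show "neutral_utility N \<rho> i r = (q - x) * marginal_utility N \<rho> x - 0 * (q - x)\<^sup>2"
        if "i < N" "x \<in> {0..1}" "q \<in> {0..1}" "r i = q" "\<And>j. j < N \<Longrightarrow> j \<noteq> i \<Longrightarrow> r j = x"
        for i x q r
        using neutral_utility_deviation[OF that(1-3), where r = r, OF that(4,5)] by simp
    qed (use assms(1) in simp_all)
    then show ?thesis
      by (simp add: X)
  qed
  \<comment> \<open>The two thresholds for \<open>\<rho>\<close> are where the slope changes sign at
    the endpoints 0 and 1. Beyond a threshold that endpoint satisfies the first-order condition and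
    hence is \<open>x\<close>.\<close>
  have at_0: "marginal_utility N \<rho> 0 \<le> 0 \<longleftrightarrow> \<rho> \<le> 1 / real N"
    using assms(1) by (simp add: marginal_utility_0 field_simps)
  have at_1: "0 \<le> marginal_utility N \<rho> 1 \<longleftrightarrow> 1 - 1 / real N \<le> \<rho>"
    using assms(1) by (simp add: marginal_utility_1 field_simps)
  have low: "\<rho> \<le> 1 / real N \<longrightarrow> x = 0"
    using unique[of 0] at_0 by (auto simp: first_order_condition_def)
  have high: "1 - 1 / real N \<le> \<rho> \<longrightarrow> x = 1"
    using unique[of 1] at_1 by (auto simp: first_order_condition_def)
  have interior: "{q \<in> {0<..<1}. \<rho> = (q - q ^ N) / (1 - q ^ N - (1 - q) ^ N)} = {x}"
    if "1 / real N < \<rho> \<and> \<rho> < 1 - 1 / real N"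
  proof -
    \<comment> \<open>Strictly between the thresholds the slope is positive at 0 and negative at 1,
      so neither endpoint qualifies and the slope vanishes at \<open>x\<close>.\<close>
    have "x \<noteq> 0" "x \<noteq> 1"
      using x that at_0 at_1 by (auto simp: first_order_condition_def)
    then have "x \<in> {0<..<1}" "marginal_utility N \<rho> x = 0"
      using x by (auto simp: first_order_condition_def)
    moreover have "q = x" if "q \<in> {0<..<1}" "marginal_utility N \<rho> q = 0" for q
      using that by (intro unique) (auto simp: first_order_condition_def)
    moreover have "2 \<le> N"
      using assms(1) by simp
    ultimately show ?thesis
      using marginal_utility_eq_0_iff by blast
  qed
  show ?thesis
    using averse neutral low high interior by blast
qed

end
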